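(* For every $R>0$, $r_0\in\mathbb{R}$, the renormalized energy of the black hole of horizon radius parameter $r_0$ and sphere radius $R$ is $$E=\frac{e^{2\phi_0+2r_0}(\alpha')^2}{8\pi G_{10}}\,N_c^2\,V(S^3)\,V(Y_5)\,\frac{T}{T_H},$$ and it satisfies $E=TS$, i.e. the free energy $F=E-TS$ vanishes. Consequently, varying $r_0$ with $V(S^3)$ (equivalently $R$) held fixed, $$\Big(\frac{\partial E}{\partial S}\Big)_V=T,\qquad \Big(\frac{\partial T}{\partial E}\Big)_V=0,$$ and the density of states $\Omega(E)$ defined at fixed volume by $\frac1T=\frac{\partial\log\Omega(E)}{\partial E}$ is $\Omega(E)=\Omega_0e^{E/T}$ with $\Omega_0$ independent of $E$; that is, in the form $\Omega(E)\propto E^{\alpha}e^{E/T}$ one has $\alpha=0$ (marginal stability).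
   Context: Constants $N_c,\alpha',G_{10}>0$ and $\phi_0\in\mathbb{R}$ are fixed. The ten-dimensional (Einstein frame) black hole metric, for $r>r_0$, is $$ds^2=e^{\phi/2}\Big[-f(r)dt^2+R^2d\Omega_3^2+\gamma\frac{dr^2}{f(r)}+N_c\alpha'\,dY_5^2\Big],\quad f(r)=1-e^{2(r_0-r)},\ \ \phi=\phi_0+r,\ \ \gamma=\frac{N_c\alpha'R^2}{R^2+N_c},$$ where $d\Omega_3^2$ is the unit round metric on $S^3$ and $dY_5^2$ is a fixed metric on a compact five-manifold $Y_5$ (independent of $r$, $t$, $R$). Put $V(S^3)=R^3\int d\Omega_3$ and $V(Y_5)=\int dY_5$. The temperature is $T=T_H\sqrt{1+N_c/R^2}$ with $T_H=\frac{1}{2\pi\sqrt{N_c\alpha'}}$. The entropy is $S=A/(4G_{10})$, where $A$ is the horizon area, $A=e^{2\phi_0+2r_0}(N_c\alpha')^{5/2}V(S^3)V(Y_5)$. The renormalized energy is $$E=-\lim_{r_{max}\to\infty}\frac{1}{8\pi G_{10}}\int_{\{r=r_{max}\}}(K_{bh}-K_{ref})\sqrt{|g_{tt}|}\;dS,$$ where $g_{tt}=-e^{\phi/2}f$ is the black hole metric component, $dS=e^{2\phi}R^3(N_c\alpha')^{5/2}d\Omega_3\,dY_5$ is the volume element induced on $\{r=r_{max}\}$ inside a constant-time slice, $K_{bh}=\nabla_\mu n^\mu$ is the extrinsic curvature (trace) of $\{r=r_{max}\}$ in the constant-time slice of the black hole metric, with $n$ the unit normal pointing towards increasing $r$, and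 $K_{ref}$ is the same quantity for the reference metric obtained by replacing $f$ by $1$ (same $\phi$, $R$, $\gamma$). *)

theory Defs
  imports "HOL-Analysis.Analysis"
begin

section \<open>Smooth Riemannian manifolds presented by atlases\<close>

definition partial :: "'n \<Rightarrow> (real^'n::finite \<Rightarrow> 'b::real_normed_vector) \<Rightarrow> real^'n \<Rightarrow> 'b" where
  "partial i F x = vector_derivative (\<lambda>s. F (x + s *\<^sub>R axis i 1)) (at 0)"

primrec Ck_on :: "nat \<Rightarrow> (real^'n::finite) set \<Rightarrow> (real^'n \<Rightarrow> 'b::real_normed_vector) \<Rightarrow> bool" where
  "Ck_on 0 U F \<longleftrightarrow> continuous_on U F"
| "Ck_on (Suc k) U F \<longleftrightarrow>
     (\<forall>x\<in>U. F differentiable (at x)) \<and> (\<forall>i. Ck_on k U (partial i F))"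

definition smooth_on :: "(real^'n::finite) set \<Rightarrow> (real^'n \<Rightarrow> 'b::real_normed_vector) \<Rightarrow> bool" where
  "smooth_on U F \<longleftrightarrow> (\<forall>k. Ck_on k U F)"

text \<open>A chart is a local parametrization of the manifold by an open subset of
  Euclidean space, together with the component matrix of the metric in the coordinates.\<close>

record ('a, 'n::finite) chart =
  chart_dom :: "(real^'n) set"
  chart_map :: "real^'n \<Rightarrow> 'a"
  chart_metric :: "real^'n \<Rightarrow> real^'n^'n"

definition coords :: "('a, 'n::finite) chart \<Rightarrow> 'a \<Rightarrow> real^'n" where
  "coords c p = inv_into (chart_dom c) (chart_map c) p"

definition riemannian_manifold :: "'a::t2_space set \<Rightarrow> ('a, 'n::finite) chart set \<Rightarrow> bool" where
  "riemannian_manifold M A \<longleftrightarrow>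
     (\<Union>c\<in>A. chart_map c ` chart_dom c) = M \<and>
     (\<forall>c\<in>A.
        open (chart_dom c) \<and>
        openin (top_of_set M) (chart_map c ` chart_dom c) \<and>
        homeomorphism (chart_dom c) (chart_map c ` chart_dom c) (chart_map c) (coords c) \<and>
        smooth_on (chart_dom c) (chart_metric c) \<and>
        (\<forall>x\<in>chart_dom c.
           transpose (chart_metric c x) = chart_metric c x \<and>
           (\<forall>v. v \<noteq> 0 \<longrightarrow> v \<bullet> (chart_metric c x *v v) > 0))) \<and>
     (\<forall>c\<in>A. \<forall>d\<in>A.
        let W = {x \<in> chart_dom c. chart_map c x \<in> chart_map d ` chart_dom d};
            \<tau> = (\<lambda>x. coords d (chart_map c x))
        in smooth_on W \<tau> \<and>
           (\<forall>x\<in>W. let J = (\<chi> i j. partial j \<tau> x $ i)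
                  in chart_metric c x = transpose J ** chart_metric d (\<tau> x) ** J))"

definition riemannian_measure ::
    "'a::t2_space set \<Rightarrow> ('a, 'n::finite) chart set \<Rightarrow> 'a measure \<Rightarrow> bool" where
  "riemannian_measure M A \<mu> \<longleftrightarrow>
     space \<mu> = M \<and> sets \<mu> = sets (restrict_space borel M) \<and>
     (\<forall>c\<in>A. \<forall>B\<in>sets \<mu>. B \<subseteq> chart_map c ` chart_dom c \<longrightarrow>
        emeasure \<mu> B =
          (\<integral>\<^sup>+x\<in>{x \<in> chart_dom c. chart_map c x \<in> B}. ennreal (sqrt (det (chart_metric c x))) \<partial>lborel))"

definition chart_at :: "('a, 'n::finite) chart set \<Rightarrow> 'a \<Rightarrow> ('a, 'n) chart" where
  "chart_at A p = (SOME c. c \<in> A \<and> p \<in> chart_map c ` chart_dom c)"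


section \<open>The unit round three-sphere\<close>

text \<open>The sphere is realised in \<open>\<real>\<^sup>3 \<times> \<real>\<close>, with the two stereographic
  parametrizations (\<open>s = 1\<close> misses the north pole, \<open>s = -1\<close> the south pole) and the
  metric induced from the ambient Euclidean inner product.\<close>

definition S3 :: "((real^3) \<times> real) set" where
  "S3 = sphere 0 1"

definition stereographic :: "real \<Rightarrow> real^3 \<Rightarrow> (real^3) \<times> real" where
  "stereographic s x =
     ((2 / (1 + (norm x)\<^sup>2)) *\<^sub>R x, s * ((norm x)\<^sup>2 - 1) / (1 + (norm x)\<^sup>2))"

definition S3_chart :: "real \<Rightarrow> ((real^3) \<times> real, 3) chart" where
  "S3_chart s =
     \<lparr>chart_dom = UNIV,
      chart_map = stereographic s,
      chart_metric = (\<lambda>x. \<chi> i j. partial i (stereographic s) x \<bullet> partial j (stereographic s) x)\<rparr>"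

definition S3_atlas :: "((real^3) \<times> real, 3) chart set" where
  "S3_atlas = {S3_chart 1, S3_chart (- 1)}"


section \<open>Divergence and extrinsic curvature\<close>

definition christoffel ::
    "(real^'n::finite \<Rightarrow> real^'n^'n) \<Rightarrow> real^'n \<Rightarrow> 'n \<Rightarrow> 'n \<Rightarrow> 'n \<Rightarrow> real" where
  "christoffel h x k i j =
     (1/2) * (\<Sum>l\<in>UNIV. matrix_inv (h x) $ k $ l *
       (partial i (\<lambda>y. h y $ l $ j) x + partial j (\<lambda>y. h y $ l $ i) x - partial l (\<lambda>y. h y $ i $ j) x))"

text \<open>\<open>\<nabla>\<^sub>\<mu> X\<^sup>\<mu>\<close> for the Levi-Civita connection of \<open>h\<close>.\<close>

definition covariant_divergence ::
    "(real^'n::finite \<Rightarrow> real^'n^'n) \<Rightarrow> (real^'n \<Rightarrow> real^'n) \<Rightarrow> real^'n \<Rightarrow> real" where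
  "covariant_divergence h X x =
     (\<Sum>\<mu>\<in>UNIV. partial \<mu> (\<lambda>y. X y $ \<mu>) x + (\<Sum>\<nu>\<in>UNIV. christoffel h x \<mu> \<mu> \<nu> * X x $ \<nu>))"

text \<open>Unit normal, at \<open>x\<close>, to the level set of the coordinate \<open>k\<close> through \<open>x\<close>,
  pointing towards increasing values of that coordinate.\<close>

definition unit_normal :: "'n \<Rightarrow> (real^'n::finite \<Rightarrow> real^'n^'n) \<Rightarrow> real^'n \<Rightarrow> real^'n" where
  "unit_normal k h x =
     (THE n. n \<bullet> (h x *v n) = 1 \<and> (\<forall>v. v $ k = 0 \<longrightarrow> n \<bullet> (h x *v v) = 0) \<and> n $ k > 0)"


section \<open>The black hole\<close>

record 'y background =
  Nc :: real
  alpha' :: real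
  G10 :: real
  phi0 :: real
  Y5 :: "'y set"
  Y5_atlas :: "('y, 5) chart set"
  dY5 :: "'y measure"
  dOmega3 :: "((real^3) \<times> real) measure"

text \<open>Coordinate indices: \<open>r\<close>, then \<open>S\<^sup>3\<close>, then \<open>Y\<^sub>5\<close> on a constant-time slice; the
  extra leading summand is the time coordinate.\<close>

type_synonym slice_idx = "unit + 3 + 5"
type_synonym spacetime_idx = "unit + slice_idx"

definition dilaton :: "'y background \<Rightarrow> real \<Rightarrow> real" where
  "dilaton B r = phi0 B + r"

definition gamma_coeff :: "'y background \<Rightarrow> real \<Rightarrow> real" where
  "gamma_coeff B R = Nc B * alpha' B * R\<^sup>2 / (R\<^sup>2 + Nc B)"

definition f_bh :: "real \<Rightarrow> real \<Rightarrow> real" where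
  "f_bh r0 r = 1 - exp (2 * (r0 - r))"

definition f_ref :: "real \<Rightarrow> real" where
  "f_ref r = 1"

text \<open>Components of the ten-dimensional metric with profile \<open>f\<close>, in the coordinates
  given by a chart \<open>c\<close> of \<open>S\<^sup>3\<close> and a chart \<open>d\<close> of \<open>Y\<^sub>5\<close>. The metric is static, so the
  components are functions of the slice coordinates only.\<close>

definition spacetime_metric ::
    "'y background \<Rightarrow> real \<Rightarrow> (real \<Rightarrow> real) \<Rightarrow> ((real^3) \<times> real, 3) chart \<Rightarrow> ('y, 5) chart \<Rightarrow>
     real^slice_idx \<Rightarrow> real^spacetime_idx^spacetime_idx" where
  "spacetime_metric B R f c d x =
     (let r = x $ Inl ();
          \<omega> = (\<chi> k. x $ Inr (Inl k));
          y = (\<chi> k. x $ Inr (Inr k))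
      in \<chi> i j. exp (dilaton B r / 2) *
           (case (i, j) of
              (Inl _, Inl _) \<Rightarrow> - f r
            | (Inr (Inl _), Inr (Inl _)) \<Rightarrow> gamma_coeff B R / f r
            | (Inr (Inr (Inl a)), Inr (Inr (Inl b))) \<Rightarrow> R\<^sup>2 * chart_metric c \<omega> $ a $ b
            | (Inr (Inr (Inr a)), Inr (Inr (Inr b))) \<Rightarrow> Nc B * alpha' B * chart_metric d y $ a $ b
            | _ \<Rightarrow> 0))"

definition slice_metric ::
    "'y background \<Rightarrow> real \<Rightarrow> (real \<Rightarrow> real) \<Rightarrow> ((real^3) \<times> real, 3) chart \<Rightarrow> ('y, 5) chart \<Rightarrow>
     real^slice_idx \<Rightarrow> real^slice_idx^slice_idx" where
  "slice_metric B R f c d x = (\<chi> i j. spacetime_metric B R f c d x $ Inr i $ Inr j)"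

definition slice_coords ::
    "((real^3) \<times> real, 3) chart \<Rightarrow> ('y, 5) chart \<Rightarrow> real \<Rightarrow> (real^3) \<times> real \<Rightarrow> 'y \<Rightarrow> real^slice_idx" where
  "slice_coords c d r p q =
     (\<chi> i. case i of Inl _ \<Rightarrow> r
            | Inr (Inl k) \<Rightarrow> coords c p $ k
            | Inr (Inr k) \<Rightarrow> coords d q $ k)"

text \<open>Scalars at the point \<open>(r, p, q)\<close> of the slice are evaluated in some chart around it;
  being scalars, they do not depend on which chart is chosen.\<close>

definition extrinsic_curvature ::
    "'y background \<Rightarrow> real \<Rightarrow> (real \<Rightarrow> real) \<Rightarrow> real \<Rightarrow> (real^3) \<times> real \<Rightarrow> 'y \<Rightarrow> real" where
  "extrinsic_curvature B R f r p q =
     (let c = chart_at S3_atlas p; d = chart_at (Y5_atlas B) q; h = slice_metric B R f c d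
      in covariant_divergence h (unit_normal (Inl ()) h) (slice_coords c d r p q))"

definition g_tt ::
    "'y background \<Rightarrow> real \<Rightarrow> (real \<Rightarrow> real) \<Rightarrow> real \<Rightarrow> (real^3) \<times> real \<Rightarrow> 'y \<Rightarrow> real" where
  "g_tt B R f r p q =
     (let c = chart_at S3_atlas p; d = chart_at (Y5_atlas B) q
      in spacetime_metric B R f c d (slice_coords c d r p q) $ Inl () $ Inl ())"

definition area_density :: "'y background \<Rightarrow> real \<Rightarrow> real \<Rightarrow> real" where
  "area_density B R r = exp (2 * dilaton B r) * R ^ 3 * (Nc B * alpha' B) powr (5/2)"

definition cutoff_energy :: "'y background \<Rightarrow> real \<Rightarrow> real \<Rightarrow> real \<Rightarrow> real" where
  "cutoff_energy B R r0 r =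
     - (1 / (8 * pi * G10 B) *
        (\<integral>(p, q). (extrinsic_curvature B R (f_bh r0) r p q - extrinsic_curvature B R f_ref r p q)
            * sqrt \<bar>g_tt B R (f_bh r0) r p q\<bar> * area_density B R r
         \<partial>(dOmega3 B \<Otimes>\<^sub>M dY5 B)))"

definition energy :: "'y background \<Rightarrow> real \<Rightarrow> real \<Rightarrow> real" where
  "energy B R r0 = Lim at_top (cutoff_energy B R r0)"


section \<open>Thermodynamics\<close>

definition vol_S3 :: "'y background \<Rightarrow> real \<Rightarrow> real" where
  "vol_S3 B R = R ^ 3 * measure (dOmega3 B) (space (dOmega3 B))"

definition vol_Y5 :: "'y background \<Rightarrow> real" where
  "vol_Y5 B = measure (dY5 B) (space (dY5 B))"

definition hagedorn_temperature :: "'y background \<Rightarrow> real" where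
  "hagedorn_temperature B = 1 / (2 * pi * sqrt (Nc B * alpha' B))"

text \<open>All state functions take the state \<open>(R, r\<^sub>0)\<close>; the temperature happens not to
  depend on \<open>r\<^sub>0\<close>.\<close>

definition temperature :: "'y background \<Rightarrow> real \<Rightarrow> real \<Rightarrow> real" where
  "temperature B R r0 = hagedorn_temperature B * sqrt (1 + Nc B / R\<^sup>2)"

definition horizon_area :: "'y background \<Rightarrow> real \<Rightarrow> real \<Rightarrow> real" where
  "horizon_area B R r0 =
     exp (2 * phi0 B + 2 * r0) * (Nc B * alpha' B) powr (5/2) * vol_S3 B R * vol_Y5 B"

definition entropy :: "'y background \<Rightarrow> real \<Rightarrow> real \<Rightarrow> real" where
  "entropy B R r0 = horizon_area B R r0 / (4 * G10 B)"

definition free_energy :: "'y background \<Rightarrow> real \<Rightarrow> real \<Rightarrow> real" where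
  "free_energy B R r0 = energy B R r0 - temperature B R r0 * entropy B R r0"

text \<open>\<open>(\<partial>Z/\<partial>X)\<^sub>V = D\<close> at the state \<open>(R, r\<^sub>0)\<close>: along the states of the given \<open>R\<close>, \<open>X\<close> is a
  coordinate, and \<open>Z\<close> expressed as a function of \<open>X\<close> has derivative \<open>D\<close>.\<close>

definition has_fixed_volume_derivative ::
    "(real \<Rightarrow> real \<Rightarrow> real) \<Rightarrow> (real \<Rightarrow> real \<Rightarrow> real) \<Rightarrow> real \<Rightarrow> real \<Rightarrow> real \<Rightarrow> bool" where
  "has_fixed_volume_derivative Z X D R r0 \<longleftrightarrow>
     inj (X R) \<and> ((\<lambda>\<xi>. Z R (inv (X R) \<xi>)) has_real_derivative D) (at (X R r0))"

definition density_of_states :: "'y background \<Rightarrow> real \<Rightarrow> (real \<Rightarrow> real) \<Rightarrow> bool" where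
  "density_of_states B R \<Omega> \<longleftrightarrow>
     (\<forall>r0. \<Omega> (energy B R r0) > 0 \<and>
        ((\<lambda>e. ln (\<Omega> e)) has_real_derivative 1 / temperature B R r0) (at (energy B R r0)))"

end

(* For a metric of which the r-direction is orthogonal to the rest, with g_rr = G(r), and whose
   tangential components all scale like exp(r/2), the terms with G' cancel in the divergence of
   G^(-1/2) d/dr: only the logarithmic derivative of the tangential volume survives, and
   K = 2 G^(-1/2) in dimension 9.  Thus the integrand of the energy is constant on S^3 x Y_5 and
   proportional to (f - sqrt f) e^(2 phi); since (1 - f) e^(2 phi) = e^(2 phi_0 + 2 r_0) for every r,
   the cut-off energy is the limit times 2 sqrt f / (1 + sqrt f), which tends to 1.
   At fixed R the energy and the entropy are both multiples of exp(2 r_0), so energy is T times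
   entropy with constant T, and log Omega is affine on the range (0, oo) of the energy. *)
theory Submission
  imports Defs
begin

section \<open>Finiteness and positivity of Riemannian volumes\<close>

lemma positive_definite_det_nonzero:
  fixes A :: "real^'n::finite^'n"
  assumes "\<And>v. v \<noteq> 0 \<Longrightarrow> v \<bullet> (A *v v) > 0"
  shows "det A \<noteq> 0"
proof -
  have "inj ((*v) A)"
  proof (rule injI)
    fix u v assume "A *v u = A *v v"
    then have "(u - v) \<bullet> (A *v (u - v)) = 0"
      by (simp add: matrix_vector_mult_diff_distrib)
    then show "u = v" using assms[of "u - v"] by fastforce
  qed
  then show ?thesis using det_nz_iff_inj[of "(*v) A"] by simp
qed

text \<open>The segment from the identity matrix to \<open>A\<close> stays positive definite, so the
  determinant never vanishes along it and keeps the sign it has at the identity. No diagonalization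
  enters, which suits an \<open>A\<close> that is not assumed symmetric.\<close>

lemma positive_definite_det_pos:
  fixes A :: "real^'n::finite^'n"
  assumes pos: "\<And>v. v \<noteq> 0 \<Longrightarrow> v \<bullet> (A *v v) > 0"
  shows "det A > 0"
proof (rule ccontr)
  assume "\<not> det A > 0"
  define P where "P t = t *\<^sub>R A + (1 - t) *\<^sub>R mat 1" for t :: real
  have P: "det (P t) \<noteq> 0" if "0 \<le> t" "t \<le> 1" for t
  proof (rule positive_definite_det_nonzero)
    fix v :: "real^'n" assume "v \<noteq> 0"
    have "v \<bullet> (P t *v v) = t * (v \<bullet> (A *v v)) + (1 - t) * (v \<bullet> v)"
      by (simp add: P_def matrix_vector_mult_add_rdistrib inner_add_right
          scaleR_matrix_vector_assoc[symmetric])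
    also have "\<dots> > 0"
      using pos[OF \<open>v \<noteq> 0\<close>] \<open>v \<noteq> 0\<close> that
      by (cases "t = 0") (auto intro!: add_pos_nonneg)
    finally show "v \<bullet> (P t *v v) > 0" .
  qed
  have "continuous_on {0..1} (\<lambda>t. det (P t))"
    unfolding det_def P_def by (auto intro!: continuous_intros)
  moreover have "det (P 0) = 1" "det (P 1) = det A" by (simp_all add: P_def)
  ultimately obtain t where "0 \<le> t" "t \<le> 1" "det (P t) = 0"
    using IVT2'[of "\<lambda>t. det (P t)" 1 0 0] \<open>\<not> det A > 0\<close> by (auto simp: not_less)
  then show False using P by blast
qed

text \<open>On a closed coordinate ball the volume density is continuous and positive, hence bounded
  above and bounded away from zero by compactness. The measure of the image of the open ball is
  thereby squeezed between positive multiples of a Lebesgue measure.\<close>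

lemma riemannian_measure_chart_ball:
  fixes M :: "'a::t2_space set" and A :: "('a, 'n::finite) chart set"
  assumes \<mu>: "riemannian_measure M A \<mu>" and c: "c \<in> A"
    and dom: "open (chart_dom c)" and x: "x \<in> chart_dom c"
    and open_map: "\<And>U. open U \<Longrightarrow> U \<subseteq> chart_dom c \<Longrightarrow> openin (top_of_set M) (chart_map c ` U)"
    and inj: "inj_on (chart_map c) (chart_dom c)"
    and cont: "continuous_on (chart_dom c) (chart_metric c)"
    and pos: "\<And>x v. x \<in> chart_dom c \<Longrightarrow> v \<noteq> 0 \<Longrightarrow> v \<bullet> (chart_metric c x *v v) > 0"
  obtains V where "openin (top_of_set M) V" "V \<in> sets \<mu>" "chart_map c x \<in> V"
    "0 < emeasure \<mu> V" "emeasure \<mu> V < \<infinity>"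
proof -
  obtain e where e: "e > 0" "cball x e \<subseteq> chart_dom c"
    using dom x by (auto simp: open_contains_cball)
  define U where "U = ball x e"
  define V where "V = chart_map c ` U"
  have U: "open U" "U \<subseteq> chart_dom c" "U \<subseteq> cball x e" "U \<noteq> {}"
    using e by (auto simp: U_def intro: order_trans[OF ball_subset_cball])
  have V: "openin (top_of_set M) V" unfolding V_def using open_map U by blast
  then obtain O' where "open O'" "V = M \<inter> O'" by (auto simp: openin_open)
  then have Vs: "V \<in> sets \<mu>"
    using \<mu> by (auto simp: riemannian_measure_def sets_restrict_space)
  define g where "g y = sqrt (det (chart_metric c y))" for y
  have gc: "continuous_on (cball x e) g"
    unfolding g_def det_def using cont e(2)
    by (auto intro!: continuous_intros intro: continuous_on_subset)
  have ne: "cball x e \<noteq> {}" using e by auto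
  obtain a where a: "a \<in> cball x e" "\<And>y. y \<in> cball x e \<Longrightarrow> g a \<le> g y"
    using continuous_attains_inf[OF compact_cball ne gc] by blast
  obtain b where b: "\<And>y. y \<in> cball x e \<Longrightarrow> g y \<le> g b"
    using continuous_attains_sup[OF compact_cball ne gc] by blast
  have ga: "g a > 0"
    unfolding g_def using a(1) e(2) by (auto intro!: positive_definite_det_pos pos)
  have preimage: "{y \<in> chart_dom c. chart_map c y \<in> V} = U"
    using inj U(2) by (auto simp: V_def inj_on_def subset_iff)
  have "V \<subseteq> chart_map c ` chart_dom c" using U by (auto simp: V_def)
  then have em: "emeasure \<mu> V = (\<integral>\<^sup>+y. ennreal (g y) * indicator U y \<partial>lborel)"
    using \<mu> c Vs preimage by (simp add: riemannian_measure_def g_def)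
  have Ub: "U \<in> sets lborel" using U by simp
  have "emeasure \<mu> V \<le> (\<integral>\<^sup>+y. ennreal (g b) * indicator U y \<partial>lborel)"
    unfolding em using b U(3)
    by (intro nn_integral_mono) (auto split: split_indicator intro!: ennreal_leI)
  also have "\<dots> = ennreal (g b) * emeasure lborel U"
    using Ub by (rule nn_integral_cmult_indicator)
  also have "\<dots> < \<infinity>"
    using emeasure_bounded_finite[of U] by (auto simp: U_def ennreal_mult_less_top)
  finally have fin: "emeasure \<mu> V < \<infinity>" .
  have "0 < ennreal (g a) * emeasure lborel U"
    using ga e(1) unfolding U_def
    by (simp add: ennreal_zero_less_mult_iff emeasure_ball unit_ball_vol_pos)
  also have "\<dots> = (\<integral>\<^sup>+y. ennreal (g a) * indicator U y \<partial>lborel)"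
    using Ub by (rule nn_integral_cmult_indicator[symmetric])
  also have "\<dots> \<le> emeasure \<mu> V"
    unfolding em using a U(3)
    by (intro nn_integral_mono) (auto split: split_indicator intro!: ennreal_leI)
  finally have "0 < emeasure \<mu> V" .
  moreover have "chart_map c x \<in> V" using e by (auto simp: V_def U_def)
  ultimately show ?thesis using that V Vs fin by blast
qed

text \<open>\<open>riemannian_measure\<close> prescribes the measure only inside single charts, so
  finiteness has to come from compactness: finitely many small coordinate balls cover
  \<open>M\<close>. The chart properties are assumed one by one, instead of through
  \<open>riemannian_manifold\<close>, so that the sphere can be treated without examining its
  transition map.\<close>

lemma compact_riemannian_measure:
  fixes M :: "'a::t2_space set" and A :: "('a, 'n::finite) chart set"
  assumes M: "compact M" "M \<noteq> {}" and \<mu>: "riemannian_measure M A \<mu>"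
    and cover: "M \<subseteq> (\<Union>c\<in>A. chart_map c ` chart_dom c)"
    and dom: "\<And>c. c \<in> A \<Longrightarrow> open (chart_dom c)"
    and open_map: "\<And>c U. c \<in> A \<Longrightarrow> open U \<Longrightarrow> U \<subseteq> chart_dom c \<Longrightarrow> openin (top_of_set M) (chart_map c ` U)"
    and inj: "\<And>c. c \<in> A \<Longrightarrow> inj_on (chart_map c) (chart_dom c)"
    and cont: "\<And>c. c \<in> A \<Longrightarrow> continuous_on (chart_dom c) (chart_metric c)"
    and pos: "\<And>c x v. c \<in> A \<Longrightarrow> x \<in> chart_dom c \<Longrightarrow> v \<noteq> 0 \<Longrightarrow> v \<bullet> (chart_metric c x *v v) > 0"
  shows "finite_measure \<mu>" and "measure \<mu> (space \<mu>) > 0"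
proof -
  have space: "space \<mu> = M" using \<mu> by (simp add: riemannian_measure_def)
  have "\<exists>V. openin (top_of_set M) V \<and> V \<in> sets \<mu> \<and> p \<in> V \<and> 0 < emeasure \<mu> V \<and> emeasure \<mu> V < \<infinity>"
    if p: "p \<in> M" for p
  proof -
    obtain c x where c: "c \<in> A" "x \<in> chart_dom c" "p = chart_map c x"
      using subsetD[OF cover p] by (auto elim!: imageE)
    then show ?thesis
      using riemannian_measure_chart_ball[OF \<mu> c(1) dom[OF c(1)] c(2) open_map[OF c(1)] inj[OF c(1)]
          cont[OF c(1)] pos[OF c(1)]] by metis
  qed
  then obtain V where V: "\<And>p. p \<in> M \<Longrightarrow> openin (top_of_set M) (V p)" "\<And>p. p \<in> M \<Longrightarrow> V p \<in> sets \<mu>"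
    "\<And>p. p \<in> M \<Longrightarrow> p \<in> V p" "\<And>p. p \<in> M \<Longrightarrow> 0 < emeasure \<mu> (V p)"
    "\<And>p. p \<in> M \<Longrightarrow> emeasure \<mu> (V p) < \<infinity>"
    by metis
  have "\<exists>\<D>\<subseteq>V ` M. finite \<D> \<and> M \<subseteq> \<Union>\<D>"
    using M(1)[unfolded compact_eq_openin_cover, rule_format, of "V ` M"] V(1,3) by blast
  then obtain F where F: "F \<subseteq> M" "finite F" "M \<subseteq> \<Union>(V ` F)"
    by (metis finite_subset_image)
  have "emeasure \<mu> M \<le> emeasure \<mu> (\<Union>(V ` F))"
    using F V(2) by (intro emeasure_mono sets.finite_UN) auto
  also have "\<dots> \<le> (\<Sum>p\<in>F. emeasure \<mu> (V p))"
    using F V(2) by (intro emeasure_subadditive_finite) auto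
  also have "\<dots> < \<infinity>" using F V(5) by (auto simp: less_top[symmetric] subset_iff)
  finally show fin: "finite_measure \<mu>" by (intro finite_measureI) (simp add: space)
  obtain p where p: "p \<in> M" using M by blast
  have "0 < emeasure \<mu> (V p)" using V p by blast
  also have "\<dots> \<le> emeasure \<mu> (space \<mu>)" by (rule emeasure_space)
  finally show "measure \<mu> (space \<mu>) > 0"
    using finite_measure.emeasure_eq_measure[OF fin, of "space \<mu>"] by simp
qed

section \<open>Stereographic charts\<close>

text \<open>\<open>partial\<close> differentiates along a coordinate line, and there the squared
  norm is the quadratic polynomial \<open>q\<close>; everything reduces to derivatives in one real
  variable.\<close>

lemma has_vector_derivative_stereographic:
  "((\<lambda>t. stereographic s (x + t *\<^sub>R axis i 1)) has_vector_derivative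
     ((- 4 * x $ i / (1 + (norm x)\<^sup>2)\<^sup>2) *\<^sub>R x + (2 / (1 + (norm x)\<^sup>2)) *\<^sub>R axis i 1,
      s * (4 * x $ i / (1 + (norm x)\<^sup>2)\<^sup>2))) (at 0)"
proof -
  define q where "q t = (norm x)\<^sup>2 + 2 * t * x $ i + t\<^sup>2" for t :: real
  have q: "(norm (x + t *\<^sub>R axis i 1))\<^sup>2 = q t" for t
    unfolding q_def power2_norm_eq_inner
    by (simp add: inner_add_left inner_add_right inner_axis inner_axis' axis_nth power2_eq_square algebra_simps)
  have q0: "1 + (norm x)\<^sup>2 \<noteq> 0" by (smt (verit) zero_le_power2)
  have d1: "((\<lambda>t. 2 / (1 + q t)) has_real_derivative - 4 * x $ i / (1 + (norm x)\<^sup>2)\<^sup>2) (at 0)"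
    unfolding q_def using q0 by (auto intro!: derivative_eq_intros simp: power2_eq_square)
  have d2: "((\<lambda>t. s * (q t - 1) / (1 + q t)) has_real_derivative s * (4 * x $ i / (1 + (norm x)\<^sup>2)\<^sup>2)) (at 0)"
    unfolding q_def using q0 by (auto intro!: derivative_eq_intros simp: power2_eq_square field_simps)
  have "((\<lambda>t. (2 / (1 + q t)) *\<^sub>R (x + t *\<^sub>R axis i 1)) has_vector_derivative
      (- 4 * x $ i / (1 + (norm x)\<^sup>2)\<^sup>2) *\<^sub>R x + (2 / (1 + (norm x)\<^sup>2)) *\<^sub>R axis i 1) (at 0)"
    by (rule has_vector_derivative_eq_rhs, rule has_vector_derivative_scaleR[OF d1])
      (auto intro!: derivative_eq_intros simp: q_def)
  from has_vector_derivative_Pair[OF this, OF d2[unfolded has_real_derivative_iff_has_vector_derivative]]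
  show ?thesis unfolding stereographic_def q .
qed

text \<open>This is the conformally flat form of the round metric. Only the square of
  \<open>s\<close> enters, so both projections are treated at once.\<close>

lemma S3_chart_metric:
  assumes "s\<^sup>2 = 1"
  shows "chart_metric (S3_chart s) x = (4 / (1 + (norm x)\<^sup>2)\<^sup>2) *\<^sub>R mat 1"
proof -
  define N where "N = 1 + (norm x)\<^sup>2"
  have N: "N \<noteq> 0" unfolding N_def by (smt (verit) zero_le_power2)
  have xx: "x \<bullet> x = N - 1" by (simp add: N_def power2_norm_eq_inner)
  have "(a *\<^sub>R x + d *\<^sub>R axis i 1) \<bullet> (b *\<^sub>R x + d *\<^sub>R axis j 1) =
      a * b * (N - 1) + d * a * x $ j + d * b * x $ i + (if i = j then d\<^sup>2 else 0)" for a b d :: real and i j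
    by (simp add: inner_add_left inner_add_right inner_axis inner_axis' xx axis_nth power2_eq_square)
      (simp add: axis_def algebra_simps)
  note ip = this
  \<comment> \<open>With \<open>u\<close> and \<open>v\<close> the two coordinates of
    \<open>x\<close> concerned, all terms containing \<open>u * v\<close> cancel, and
    \<open>D\<close> is the surviving diagonal term. Writing \<open>m\<close> for
    \<open>1 / N\<close> leaves a polynomial identity modulo \<open>N * m = 1\<close> and the
    hypothesis on \<open>s\<close>.\<close>
  have cancel: "(- 4 * u / N\<^sup>2) * (- 4 * v / N\<^sup>2) * (N - 1) + 2 / N * (- 4 * u / N\<^sup>2) * v
      + 2 / N * (- 4 * v / N\<^sup>2) * u + D + (s * (4 * u / N\<^sup>2)) * (s * (4 * v / N\<^sup>2)) = D" for u v D
  proof -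
    define m where "m = 1 / N"
    have "N * m = 1" using N by (simp add: m_def)
    then have "(- 4 * u * m\<^sup>2) * (- 4 * v * m\<^sup>2) * (N - 1) + 2 * m * (- 4 * u * m\<^sup>2) * v
      + 2 * m * (- 4 * v * m\<^sup>2) * u + D + (s * (4 * u * m\<^sup>2)) * (s * (4 * v * m\<^sup>2)) = D"
      using assms by algebra
    then show ?thesis by (simp add: m_def power_divide)
  qed
  have "partial i (stereographic s) x \<bullet> partial j (stereographic s) x = (if i = j then 4 / N\<^sup>2 else 0)" for i j
    unfolding partial_def has_vector_derivative_stereographic[THEN vector_derivative_at]
      N_def[symmetric] inner_Pair ip inner_real_def cancel by (simp add: power_divide)
  then show ?thesis
    by (simp add: S3_chart_def vec_eq_iff mat_def N_def)
qed

lemma stereographic_in_S3: "s\<^sup>2 = 1 \<Longrightarrow> stereographic s x \<in> S3"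
proof -
  assume s: "s\<^sup>2 = 1"
  have N: "1 + (norm x)\<^sup>2 \<noteq> 0" by (smt (verit) zero_le_power2)
  have "(norm (stereographic s x))\<^sup>2 = 1"
    using N s by (simp add: stereographic_def norm_Pair power_mult_distrib power_divide divide_simps)
      (simp add: power2_eq_square algebra_simps)
  then have "norm (stereographic s x) = 1" by (simp add: power2_eq_1_iff) (smt (verit) norm_ge_zero)
  then show ?thesis by (simp add: S3_def)
qed

text \<open>The projection from the pole \<open>s * snd p = 1\<close> divides \<open>fst p\<close>
  by \<open>1 - s * snd p\<close>; the first claim keeps that division meaningful on the
  image.\<close>

lemma stereographic_left_inverse:
  assumes "s\<^sup>2 = 1"
  shows "s * snd (stereographic s x) \<noteq> 1"
    and "(1 / (1 - s * snd (stereographic s x))) *\<^sub>R fst (stereographic s x) = x"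
proof -
  have N: "1 + (norm x)\<^sup>2 > 0" by (smt (verit) zero_le_power2)
  have "s * snd (stereographic s x) = s\<^sup>2 * ((norm x)\<^sup>2 - 1) / (1 + (norm x)\<^sup>2)"
    by (simp add: stereographic_def power2_eq_square)
  then have *: "1 - s * snd (stereographic s x) = 2 / (1 + (norm x)\<^sup>2)"
    using N assms by (simp add: field_simps)
  then show "s * snd (stereographic s x) \<noteq> 1" using N by auto
  show "(1 / (1 - s * snd (stereographic s x))) *\<^sub>R fst (stereographic s x) = x"
    unfolding * unfolding stereographic_def fst_conv scaleR_scaleR
    using N by (metis (no_types) divide_divide_eq_right divide_self_if div_by_1 mult_1 less_numeral_extra(3) nonzero_mult_div_cancel_left divide_eq_0_iff scaleR_one times_divide_eq_right zero_neq_numeral)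
qed

lemma stereographic_right_inverse:
  assumes s: "s\<^sup>2 = 1" and p: "p \<in> S3" "s * snd p \<noteq> 1"
  shows "stereographic s ((1 / (1 - s * snd p)) *\<^sub>R fst p) = p"
proof -
  \<comment> \<open>In terms of \<open>u\<close> the equation of the sphere says that
    \<open>fst p\<close> has squared norm \<open>u * (2 - u)\<close>, so the projected point has
    squared norm \<open>2 / u - 1\<close>.\<close>
  define u where "u = 1 - s * snd p"
  have u: "u \<noteq> 0" using p by (simp add: u_def)
  have "norm p = 1" using p by (simp add: S3_def)
  then have "(norm (fst p))\<^sup>2 + (snd p)\<^sup>2 = 1"
    by (metis norm_Pair prod.collapse power2_abs real_norm_def real_sqrt_eq_1_iff)
  moreover have "(snd p)\<^sup>2 = (1 - u)\<^sup>2" using s by (simp add: u_def power_mult_distrib)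
  ultimately have f: "(norm (fst p))\<^sup>2 = u * (2 - u)" by (simp add: power2_eq_square algebra_simps)
  have q: "(norm ((1 / u) *\<^sub>R fst p))\<^sup>2 = 2 / u - 1"
    using u f by (simp add: power_mult_distrib power_divide) (simp add: field_simps power2_eq_square)
  have t: "s * (1 - u) = snd p" using s by (simp add: u_def power2_eq_square mult.assoc[symmetric])
  have "2 / (1 + (2 / u - 1)) = u" "s * (2 / u - 1 - 1) / (1 + (2 / u - 1)) = s * (1 - u)"
    using u by (simp_all add: field_simps)
  then show ?thesis
    unfolding u_def[symmetric] stereographic_def q t using u by simp
qed

text \<open>The explicit inverse is continuous off the pole, so the image of \<open>U\<close> is the
  trace on the sphere of the open set which that inverse sends into \<open>U\<close>.\<close>

lemma stereographic_open_map:
  assumes s: "s\<^sup>2 = 1" and U: "open U"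
  shows "openin (top_of_set S3) (stereographic s ` U)"
proof -
  define i where "i p = (1 / (1 - s * snd p)) *\<^sub>R fst p" for p :: "(real^3) \<times> real"
  define W where "W = {p :: (real^3) \<times> real. s * snd p \<noteq> 1}"
  have W: "open W" unfolding W_def by (intro open_Collect_neq continuous_intros)
  have "continuous_on W i" unfolding i_def W_def by (auto intro!: continuous_intros)
  then have "open (W \<inter> i -` U)" using W U by (simp add: continuous_on_open_vimage Int_commute)
  moreover have "stereographic s ` U = S3 \<inter> (W \<inter> i -` U)"
  proof (intro equalityI subsetI)
    fix p assume "p \<in> stereographic s ` U"
    then show "p \<in> S3 \<inter> (W \<inter> i -` U)"
      using stereographic_in_S3[OF s] stereographic_left_inverse[OF s] by (auto simp: W_def i_def)
  next
    fix p assume "p \<in> S3 \<inter> (W \<inter> i -` U)"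
    then have "stereographic s (i p) = p" "i p \<in> U"
      using stereographic_right_inverse[OF s, of p] by (auto simp: W_def i_def)
    then show "p \<in> stereographic s ` U" by (metis imageI)
  qed
  ultimately show ?thesis unfolding openin_open by blast
qed

lemma S3_atlas_cases:
  assumes "c \<in> S3_atlas"
  obtains s where "s\<^sup>2 = 1" "c = S3_chart s"
proof -
  have "c = S3_chart 1 \<or> c = S3_chart (- 1)" using assms by (simp add: S3_atlas_def)
  then show thesis using that[of 1] that[of "- 1"] by auto
qed

lemma S3_atlas_cover: "S3 \<subseteq> (\<Union>c\<in>S3_atlas. chart_map c ` chart_dom c)"
proof
  fix p assume p: "p \<in> S3"
  have "1 * snd p \<noteq> 1 \<or> - 1 * snd p \<noteq> 1" by linarith
  then obtain s :: real where s: "s = 1 \<or> s = - 1" "s * snd p \<noteq> 1" by blast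
  then have "s\<^sup>2 = 1" by auto
  then have "p \<in> range (stereographic s)"
    using stereographic_right_inverse[OF _ p s(2)] by (metis rangeI)
  then show "p \<in> (\<Union>c\<in>S3_atlas. chart_map c ` chart_dom c)"
    using s(1) by (auto simp: S3_atlas_def S3_chart_def)
qed

lemma S3_atlas_positive_definite:
  assumes "c \<in> S3_atlas" "v \<noteq> 0"
  shows "v \<bullet> (chart_metric c x *v v) > 0"
proof -
  obtain s where s: "s\<^sup>2 = 1" "c = S3_chart s" using assms(1) by (rule S3_atlas_cases)
  have "1 + (norm x)\<^sup>2 \<noteq> 0" by (smt (verit) zero_le_power2)
  then show ?thesis using assms(2)
    unfolding s(2) S3_chart_metric[OF s(1)] scaleR_matrix_vector_assoc[symmetric] by simp
qed

lemma S3_atlas_chart: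
  assumes "c \<in> S3_atlas"
  shows "chart_dom c = UNIV"
    and "open U \<Longrightarrow> openin (top_of_set S3) (chart_map c ` U)"
    and "inj (chart_map c)"
    and "continuous_on X (chart_metric c)"
proof -
  obtain s where s: "s\<^sup>2 = 1" "c = S3_chart s" using assms by (rule S3_atlas_cases)
  show "chart_dom c = UNIV" using s by (simp add: S3_chart_def)
  show "open U \<Longrightarrow> openin (top_of_set S3) (chart_map c ` U)"
    using s stereographic_open_map by (simp add: S3_chart_def)
  show "inj (chart_map c)"
    using stereographic_left_inverse(2)[OF s(1)] unfolding s(2) S3_chart_def
    by (simp, intro inj_on_inverseI)
  have "chart_metric c = (\<lambda>x. (4 / (1 + (norm x)\<^sup>2)\<^sup>2) *\<^sub>R mat 1)"
    using S3_chart_metric[OF s(1)] unfolding s(2) by (rule ext)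
  moreover have "1 + (norm x)\<^sup>2 \<noteq> 0" for x :: "real^3" by (smt (verit) zero_le_power2)
  ultimately show "continuous_on X (chart_metric c)" by (auto intro!: continuous_intros)
qed

section \<open>The mean curvature of the radial level sets\<close>

text \<open>A partial derivative sees only the germ of a function. Hence formulas for the metric and
  its normal that hold merely on an open set can be differentiated there.\<close>

lemma partial_cong:
  assumes "open U" "x \<in> U" and eq: "\<And>y. y \<in> U \<Longrightarrow> F y = F' y"
  shows "partial i F x = partial i F' x"
proof -
  have "open ((\<lambda>s :: real. x + s *\<^sub>R axis i 1) -` U)"
    using assms(1) by (intro open_vimage continuous_intros)
  then have "eventually (\<lambda>s. x + s *\<^sub>R axis i 1 \<in> U) (nhds (0::real))"
    using assms(2) by (force simp: eventually_nhds)
  then have ev: "eventually (\<lambda>s. F (x + s *\<^sub>R axis i 1) = F' (x + s *\<^sub>R axis i 1)) (nhds (0::real))"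
    by eventually_elim (rule eq)
  show ?thesis
    unfolding partial_def using ev by (intro vector_derivative_cong_eq) auto
qed

lemma partial_zero [simp]: "partial i (\<lambda>_. 0) x = 0"
  by (simp add: partial_def)

lemma partial_component:
  assumes "(g has_real_derivative D) (at (x $ k))"
  shows "partial i (\<lambda>y. g (y $ k)) x = (if i = k then D else 0)"
proof (cases "i = k")
  case True
  have "((\<lambda>s. g (x $ k + s)) has_real_derivative D) (at 0)"
    using assms DERIV_shift[of g D 0 "x $ k"] by (simp add: add.commute)
  then show ?thesis
    using True by (simp add: partial_def axis_nth has_real_derivative_iff_has_vector_derivative
        vector_derivative_at)
next
  case False
  then show ?thesis by (simp add: partial_def axis_def)
qed

text \<open>\<open>unit_normal\<close> is a definite description, so its value is known only after
  uniqueness has been shown; positive definiteness supplies it.\<close>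

lemma unit_normal_orthogonal_coordinate:
  fixes h :: "real^'n::finite \<Rightarrow> real^'n^'n"
  assumes off: "\<And>j. j \<noteq> k \<Longrightarrow> h x $ j $ k = 0" "\<And>j. j \<noteq> k \<Longrightarrow> h x $ k $ j = 0"
    and pos: "\<And>v. v \<noteq> 0 \<Longrightarrow> v \<bullet> (h x *v v) > 0"
  shows "unit_normal k h x = (1 / sqrt (h x $ k $ k)) *\<^sub>R axis k 1"
proof -
  define g where "g = h x $ k $ k"
  have col: "h x *v axis k 1 = g *\<^sub>R axis k 1"
    using off(1) by (simp add: vec_eq_iff g_def matrix_vector_mul_component inner_axis' inner_axis)
      (auto simp: axis_def)
  have row: "axis k 1 \<bullet> (h x *v v) = g * v $ k" for v
    using off(2) by (simp add: inner_axis' matrix_vector_mult_def g_def)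
      (subst sum.remove[of _ k]; simp)
  have g: "g > 0" using pos[of "axis k 1"] row[of "axis k 1"] by (simp add: axis_def vec_eq_iff split: if_splits)
  show ?thesis
    unfolding unit_normal_def g_def[symmetric]
  proof (rule the_equality)
    show "(1 / sqrt g) *\<^sub>R axis k 1 \<bullet> (h x *v (1 / sqrt g) *\<^sub>R axis k 1) = 1 \<and>
      (\<forall>v. v $ k = 0 \<longrightarrow> (1 / sqrt g) *\<^sub>R axis k 1 \<bullet> (h x *v v) = 0) \<and> ((1 / sqrt g) *\<^sub>R axis k (1 :: real)) $ k > 0"
      using g by (simp add: row matrix_vector_mult_scaleR col axis_nth)
  next
    fix n assume n: "n \<bullet> (h x *v n) = 1 \<and> (\<forall>v. v $ k = 0 \<longrightarrow> n \<bullet> (h x *v v) = 0) \<and> n $ k > 0"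
    \<comment> \<open>\<open>w\<close> is the part of \<open>n\<close> tangent to the level set. It
      is orthogonal to \<open>n\<close> by the second condition and to the axis by the vanishing
      row, so its own length is zero.\<close>
    define w where "w = n - (n $ k) *\<^sub>R axis k 1"
    have wk: "w $ k = 0" by (simp add: w_def axis_def)
    have n_eq: "n = w + (n $ k) *\<^sub>R axis k 1" by (simp add: w_def)
    have "w \<bullet> (h x *v w) = n \<bullet> (h x *v w) - n $ k * (axis k 1 \<bullet> (h x *v w))"
      by (simp add: w_def inner_diff_left)
    also have "\<dots> = 0" using n wk by (simp add: row)
    finally have "w = 0" using pos[of w] by fastforce
    then have n_ax: "n = (n $ k) *\<^sub>R axis k 1" using n_eq by simp
    have "(n $ k)\<^sup>2 * g = 1"
      using n by (subst (asm) (1 2) n_ax)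
        (simp add: row matrix_vector_mult_scaleR col axis_nth power2_eq_square mult_ac)
    then have "(n $ k)\<^sup>2 = 1 / g" using g by (simp add: field_simps)
    then have "n $ k = 1 / sqrt g"
      using n by (metis abs_of_pos real_sqrt_abs real_sqrt_divide real_sqrt_one)
    then show "n = (1 / sqrt g) *\<^sub>R axis k 1" using n_ax by simp
  qed
qed

text \<open>By \<open>tang\<close>, all entries other than the one at \<open>k\<close>,
  \<open>k\<close> grow at the logarithmic rate \<open>L\<close>; each tangential direction then
  contributes \<open>L / 2\<close> to the contracted Christoffel symbol, whence the factor one less
  than the dimension. The block shape is imposed on a neighbourhood because the normal field is
  differentiated, the rate at \<open>x\<close> alone.\<close>

lemma divergence_unit_normal:
  fixes h :: "real^'n::finite \<Rightarrow> real^'n^'n" and x :: "real^'n" and L :: real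
  assumes U: "open U" "x \<in> U"
    and off: "\<And>y j. y \<in> U \<Longrightarrow> j \<noteq> k \<Longrightarrow> h y $ j $ k = 0" "\<And>y j. y \<in> U \<Longrightarrow> j \<noteq> k \<Longrightarrow> h y $ k $ j = 0"
    and pos: "\<And>y v. y \<in> U \<Longrightarrow> v \<noteq> 0 \<Longrightarrow> v \<bullet> (h y *v v) > 0"
    and kk: "\<And>y. y \<in> U \<Longrightarrow> h y $ k $ k = G (y $ k)"
    and G': "(G has_real_derivative G') (at (x $ k))"
    and tang: "\<And>i j. (i, j) \<noteq> (k, k) \<Longrightarrow> partial k (\<lambda>y. h y $ i $ j) x = L * h x $ i $ j"
  shows "covariant_divergence h (unit_normal k h) x = L * (real CARD('n) - 1) / (2 * sqrt (G (x $ k)))"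
proof -
  define g where "g = G (x $ k)"
  define H where "H = matrix_inv (h x)"
  have n: "unit_normal k h y = (1 / sqrt (G (y $ k))) *\<^sub>R axis k 1" if "y \<in> U" for y
    using that off pos kk by (simp add: unit_normal_orthogonal_coordinate)
  have "axis k 1 \<bullet> (h x *v axis k 1) = g"
    using kk U by (simp add: g_def inner_axis' matrix_vector_mult_basis column_def)
  then have g: "g > 0" using pos[OF U(2), of "axis k 1"] by (simp add: axis_eq_0_iff)
  have "(h x) ** H = mat 1 \<and> H ** h x = mat 1"
  proof -
    have "invertible (h x)"
      using positive_definite_det_nonzero[OF pos[OF U(2)]] by (simp add: invertible_det_nz)
    then show ?thesis
      unfolding H_def matrix_inv_def invertible_def by (rule someI_ex)
  qed
  then have HH: "(\<Sum>l\<in>UNIV. H $ i $ l * h x $ l $ j) = (if i = j then 1 else 0)" for i j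
    by (auto simp: matrix_matrix_mult_def mat_def vec_eq_iff)
  have Hg: "H $ k $ k * g = 1"
  proof -
    have "(\<Sum>l\<in>UNIV. H $ k $ l * h x $ l $ k) = H $ k $ k * h x $ k $ k"
      using off(1)[OF U(2)] by (subst sum.remove[of _ k]) auto
    then show ?thesis using HH[of k k] kk U by (simp add: g_def)
  qed
  have d_k: "partial i (\<lambda>y. h y $ l $ k) x = (if i = k \<and> l = k then G' else 0)" for i l
  proof (cases "l = k")
    case True
    have "partial i (\<lambda>y. h y $ l $ k) x = partial i (\<lambda>y. G (y $ k)) x"
      using True kk by (intro partial_cong[OF U]) auto
    then show ?thesis using True partial_component[OF G'] by simp
  next
    case False
    have "partial i (\<lambda>y. h y $ l $ k) x = partial i (\<lambda>y. 0 :: real) x"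
      using False off by (intro partial_cong[OF U]) auto
    then show ?thesis using False by simp
  qed
  \<comment> \<open>The entry at \<open>k\<close>, \<open>k\<close> obeys the rate \<open>L\<close>
    up to the defect \<open>G' - L * g\<close>. One formula thus covers all entries, and the sum
    against the inverse matrix collapses to \<open>L\<close> plus a single correction.\<close>
  have d_t: "partial k (\<lambda>y. h y $ l $ i) x = L * h x $ l $ i + (if l = k \<and> i = k then G' - L * g else 0)" for l i
    using tang[of l i] d_k[of k k] kk U by (auto simp: g_def)
  \<comment> \<open>Of the three derivatives in the symbol, the two that involve column
    \<open>k\<close> of the metric cancel by \<open>d_k\<close>, which leaves the one in direction
    \<open>k\<close>.\<close>
  have \<Gamma>: "christoffel h x i i k = 1/2 * (L + (if i = k then H $ k $ k * (G' - L * g) else 0))" for i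
  proof -
    have "christoffel h x i i k = 1/2 * (\<Sum>l\<in>UNIV. H $ i $ l * partial k (\<lambda>y. h y $ l $ i) x)"
      unfolding christoffel_def H_def[symmetric] d_k by (intro arg_cong2[of _ _ _ _ "(*)"] sum.cong) auto
    also have "(\<Sum>l\<in>UNIV. H $ i $ l * partial k (\<lambda>y. h y $ l $ i) x) =
        L * (\<Sum>l\<in>UNIV. H $ i $ l * h x $ l $ i) + (\<Sum>l\<in>UNIV. if l = k then H $ i $ l * (if i = k then G' - L * g else 0) else 0)"
      unfolding sum_distrib_left sum.distrib[symmetric] d_t by (intro sum.cong) (auto simp: algebra_simps)
    finally show ?thesis using HH[of i i] by simp
  qed
  have d_n: "partial i (\<lambda>y. unit_normal k h y $ i) x = (if i = k then - G' / (2 * g * sqrt g) else 0)" for i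
  proof -
    have "partial i (\<lambda>y. unit_normal k h y $ i) x = partial i (\<lambda>y. if i = k then 1 / sqrt (G (y $ k)) else 0) x"
      using n by (intro partial_cong[OF U]) (auto simp: axis_def)
    moreover have "((\<lambda>t. 1 / sqrt (G t)) has_real_derivative - G' / (2 * g * sqrt g)) (at (x $ k))"
      using G' g by (auto intro!: derivative_eq_intros simp: g_def[symmetric] field_simps)
    ultimately show ?thesis using partial_component[of "\<lambda>t. 1 / sqrt (G t)" _ x k i] by (cases "i = k") simp_all
  qed
  have cancel: "- G' / (2 * g * q) + 1/2 * (L * m + 1 / g * (G' - L * g)) / q = L * (m - 1) / (2 * q)"
    if "q > 0" for q m :: real
    using that g by (simp add: field_simps)
  have "covariant_divergence h (unit_normal k h) x =
      (\<Sum>i\<in>UNIV. (if i = k then - G' / (2 * g * sqrt g) else 0) + christoffel h x i i k / sqrt g)"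
    unfolding covariant_divergence_def d_n n[OF U(2)]
    by (intro sum.cong refl) (simp add: axis_def g_def if_distrib cong: if_cong)
  also have "\<dots> = - G' / (2 * g * sqrt g) + (\<Sum>i\<in>UNIV. christoffel h x i i k) / sqrt g"
    by (simp add: sum.distrib sum_divide_distrib)
  also have "(\<Sum>i\<in>UNIV. christoffel h x i i k) = 1/2 * (L * real CARD('n) + H $ k $ k * (G' - L * g))"
    unfolding \<Gamma> sum_distrib_left[symmetric] sum.distrib by simp
  also have "H $ k $ k = 1 / g" using Hg g by (simp add: field_simps)
  also have "- G' / (2 * g * sqrt g) + 1/2 * (L * real CARD('n) + 1 / g * (G' - L * g)) / sqrt g
      = L * (real CARD('n) - 1) / (2 * sqrt g)"
    using cancel[of "sqrt g"] g by simp
  finally show ?thesis by (simp add: g_def)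
qed

section \<open>Block structure of the slice metric and its radial mean curvature\<close>

lemma sum_UNIV_Plus:
  "(\<Sum>i\<in>UNIV. g (i :: 'a::finite + 'b::finite)) = (\<Sum>a\<in>UNIV. g (Inl a)) + (\<Sum>b\<in>UNIV. g (Inr b))"
  unfolding UNIV_Plus_UNIV[symmetric] by (subst sum.Plus) auto

lemma slice_metric_component:
  "slice_metric B R f c d x $ i $ j = exp (dilaton B (x $ Inl ()) / 2) *
     (case (i, j) of
        (Inl _, Inl _) \<Rightarrow> gamma_coeff B R / f (x $ Inl ())
      | (Inr (Inl a), Inr (Inl b)) \<Rightarrow> R\<^sup>2 * chart_metric c (\<chi> k. x $ Inr (Inl k)) $ a $ b
      | (Inr (Inr a), Inr (Inr b)) \<Rightarrow> Nc B * alpha' B * chart_metric d (\<chi> k. x $ Inr (Inr k)) $ a $ b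
      | _ \<Rightarrow> 0)"
  by (simp add: slice_metric_def spacetime_metric_def Let_def split: sum.split)

lemma slice_metric_quadratic_form:
  "v \<bullet> (slice_metric B R f c d x *v v) = exp (dilaton B (x $ Inl ()) / 2) *
     (gamma_coeff B R / f (x $ Inl ()) * (v $ Inl ())\<^sup>2
      + R\<^sup>2 * ((\<chi> k. v $ Inr (Inl k)) \<bullet> (chart_metric c (\<chi> k. x $ Inr (Inl k)) *v (\<chi> k. v $ Inr (Inl k))))
      + Nc B * alpha' B * ((\<chi> k. v $ Inr (Inr k)) \<bullet> (chart_metric d (\<chi> k. x $ Inr (Inr k)) *v (\<chi> k. v $ Inr (Inr k)))))"
  by (simp add: inner_vec_def matrix_vector_mult_def sum_UNIV_Plus slice_metric_component UNIV_unit
      distrib_left sum_distrib_left power2_eq_square mult_ac)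

lemma slice_metric_positive_definite:
  assumes "Nc B > 0" "alpha' B > 0" "R > 0" "f (x $ Inl ()) > 0"
    and c: "\<And>w. w \<noteq> 0 \<Longrightarrow> w \<bullet> (chart_metric c (\<chi> k. x $ Inr (Inl k)) *v w) > 0"
    and d: "\<And>w. w \<noteq> 0 \<Longrightarrow> w \<bullet> (chart_metric d (\<chi> k. x $ Inr (Inr k)) *v w) > 0"
    and "v \<noteq> 0"
  shows "v \<bullet> (slice_metric B R f c d x *v v) > 0"
proof -
  define w1 w2 where "w1 = (\<chi> k. v $ Inr (Inl k))" and "w2 = (\<chi> k. v $ Inr (Inr k))"
  have g: "gamma_coeff B R / f (x $ Inl ()) > 0"
    using assms by (simp add: gamma_coeff_def add_pos_pos)
  have N: "Nc B * alpha' B > 0" "R\<^sup>2 > 0" using assms by auto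
  have ge: "w1 \<bullet> (chart_metric c (\<chi> k. x $ Inr (Inl k)) *v w1) \<ge> 0"
      "w2 \<bullet> (chart_metric d (\<chi> k. x $ Inr (Inr k)) *v w2) \<ge> 0"
    using c[of w1] d[of w2] by (cases "w1 = 0"; cases "w2 = 0"; force)+
  have "v $ Inl () \<noteq> 0 \<or> w1 \<noteq> 0 \<or> w2 \<noteq> 0"
  proof (rule ccontr)
    assume "\<not> ?thesis"
    then have "v $ i = 0" for i
      by (cases i; rename_tac b, case_tac b) (auto simp: w1_def w2_def vec_eq_iff)
    then show False using \<open>v \<noteq> 0\<close> by (simp add: vec_eq_iff)
  qed
  moreover have "0 \<le> a * b" "0 < b \<Longrightarrow> 0 < a * b" if "0 < a" "0 \<le> b" for a b :: real
    using that by auto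
  note this[OF g, of "(v $ Inl ())\<^sup>2"] this[OF N(2) ge(1)] this[OF N(1) ge(2)]
  ultimately have "0 < gamma_coeff B R / f (x $ Inl ()) * (v $ Inl ())\<^sup>2
      + R\<^sup>2 * (w1 \<bullet> (chart_metric c (\<chi> k. x $ Inr (Inl k)) *v w1))
      + Nc B * alpha' B * (w2 \<bullet> (chart_metric d (\<chi> k. x $ Inr (Inr k)) *v w2))"
    using c[of w1] d[of w2] by (smt (verit) zero_less_power2 zero_le_power2)
  then show ?thesis unfolding slice_metric_quadratic_form w1_def[symmetric] w2_def[symmetric] by simp
qed

text \<open>An instance of the divergence formula for the radial index, with the rate 1/2 coming
  from the common factor \<open>exp (dilaton B r / 2)\<close>.\<close>

lemma slice_mean_curvature:
  assumes B: "Nc B > 0" "alpha' B > 0" "R > 0" and f: "continuous_on UNIV f" "f r > 0"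
    and f': "(f has_real_derivative f') (at r)"
    and c: "open (chart_dom c)" "\<And>y v. y \<in> chart_dom c \<Longrightarrow> v \<noteq> 0 \<Longrightarrow> v \<bullet> (chart_metric c y *v v) > 0"
    and d: "open (chart_dom d)" "\<And>y v. y \<in> chart_dom d \<Longrightarrow> v \<noteq> 0 \<Longrightarrow> v \<bullet> (chart_metric d y *v v) > 0"
    and x: "x $ Inl () = r" "(\<chi> k. x $ Inr (Inl k)) \<in> chart_dom c" "(\<chi> k. x $ Inr (Inr k)) \<in> chart_dom d"
  shows "covariant_divergence (slice_metric B R f c d) (unit_normal (Inl ()) (slice_metric B R f c d)) x
    = 2 * sqrt (f r / gamma_coeff B R) * exp (- dilaton B r / 4)"
proof -
  define h where "h = slice_metric B R f c d"
  define G where "G t = exp (dilaton B t / 2) * (gamma_coeff B R / f t)" for t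
  \<comment> \<open>On \<open>U\<close> the slice metric is positive definite; continuity of
    \<open>f\<close> on the whole line makes the radial condition open.\<close>
  define U where "U = {y :: real^slice_idx. f (y $ Inl ()) > 0 \<and>
    (\<chi> k. y $ Inr (Inl k)) \<in> chart_dom c \<and> (\<chi> k. y $ Inr (Inr k)) \<in> chart_dom d}"
  have Uopen: "open U"
  proof -
    have 1: "open {y :: real^slice_idx. 0 < f (y $ Inl ())}"
      by (intro open_Collect_less continuous_on_const continuous_on_compose2[OF f(1)] continuous_intros) auto
    have "open ((\<lambda>y :: real^slice_idx. (\<chi> k. y $ Inr (Inl k)) :: real^3) -` chart_dom c)"
      by (intro open_vimage c continuous_intros)
    moreover have "open ((\<lambda>y :: real^slice_idx. (\<chi> k. y $ Inr (Inr k)) :: real^5) -` chart_dom d)"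
      by (intro open_vimage d continuous_intros)
    ultimately have "open ({y :: real^slice_idx. 0 < f (y $ Inl ())} \<inter>
        (\<lambda>y. (\<chi> k. y $ Inr (Inl k))) -` chart_dom c \<inter> (\<lambda>y. (\<chi> k. y $ Inr (Inr k))) -` chart_dom d)"
      using 1 by blast
    moreover have "\<dots> = U" by (auto simp: U_def)
    ultimately show ?thesis by simp
  qed
  have Ux: "x \<in> U" using x f by (simp add: U_def)
  have \<gamma>: "gamma_coeff B R > 0" using B by (simp add: gamma_coeff_def add_pos_pos)
  have "(G has_real_derivative
      exp (dilaton B r / 2) * (gamma_coeff B R / f r) / 2 - exp (dilaton B r / 2) * gamma_coeff B R * f' / (f r)\<^sup>2) (at (x $ Inl ()))"
    unfolding G_def dilaton_def x(1) using f(2) f'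
    by (auto intro!: derivative_eq_intros simp: power2_eq_square)
      (simp add: field_simps)
  moreover have "partial (Inl ()) (\<lambda>y. h y $ i $ j) x = (1/2) * h x $ i $ j"
    if ij: "(i, j) \<noteq> (Inl (), Inl ())" for i j
  proof -
    \<comment> \<open>\<open>m\<close> is the component stripped of the conformal factor. Moving
      along the radial axis leaves the arguments of both chart metrics fixed, so \<open>m\<close> is
      constant and only the exponential is differentiated.\<close>
    define m where "m = (case (i, j) of
        (Inr (Inl a), Inr (Inl b)) \<Rightarrow> R\<^sup>2 * chart_metric c (\<chi> k. x $ Inr (Inl k)) $ a $ b
      | (Inr (Inr a), Inr (Inr b)) \<Rightarrow> Nc B * alpha' B * chart_metric d (\<chi> k. x $ Inr (Inr k)) $ a $ b
      | _ \<Rightarrow> 0)"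
    have h: "h (x + s *\<^sub>R axis (Inl ()) 1) $ i $ j = exp (dilaton B (r + s) / 2) * m" for s
      using ij unfolding h_def slice_metric_component m_def
      by (cases i; cases j) (auto simp: axis_def x(1) split: sum.split)
    have "((\<lambda>s. exp (dilaton B (r + s) / 2) * m) has_real_derivative (1/2) * (exp (dilaton B r / 2) * m)) (at 0)"
      unfolding dilaton_def by (auto intro!: derivative_eq_intros)
    moreover have "h x $ i $ j = exp (dilaton B r / 2) * m" using h[of 0] by simp
    ultimately show ?thesis
      unfolding partial_def h
      by (simp add: has_real_derivative_iff_has_vector_derivative vector_derivative_at)
  qed
  moreover have "v \<bullet> (h y *v v) > 0" if "y \<in> U" "v \<noteq> 0" for y v
    using that B c d unfolding h_def U_def by (intro slice_metric_positive_definite) auto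
  moreover have "h y $ j $ Inl () = 0 \<and> h y $ Inl () $ j = 0" if "j \<noteq> Inl ()" for y j
    using that by (cases j) (auto simp: h_def slice_metric_component split: sum.split)
  moreover have "h y $ Inl () $ Inl () = G (y $ Inl ())" for y
    by (simp add: h_def slice_metric_component G_def)
  ultimately have "covariant_divergence h (unit_normal (Inl ()) h) x
      = (1/2) * (real CARD(slice_idx) - 1) / (2 * sqrt (G (x $ Inl ())))"
    using Uopen Ux by (intro divergence_unit_normal[of U]) auto
  \<comment> \<open>The index type has 1 + 3 + 5 = 9 elements, so the constant is (1/2) * 8 / 2 =
    2.\<close>
  also have "\<dots> = 2 / sqrt (G r)" by (simp add: x(1))
  also have "sqrt (G r) = exp (dilaton B r / 4) / sqrt (f r / gamma_coeff B R)"
  proof -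
    have "sqrt (exp (dilaton B r / 2)) = exp (dilaton B r / 4)"
      by (rule real_sqrt_unique) (simp_all add: power2_eq_square exp_add[symmetric])
    then show ?thesis by (simp add: G_def real_sqrt_mult real_sqrt_divide)
  qed
  finally show ?thesis by (simp add: h_def exp_minus field_simps)
qed

section \<open>The cut-off energy\<close>

lemma chart_at_coords:
  assumes "p \<in> (\<Union>c\<in>A. chart_map c ` chart_dom c)"
  shows "chart_at A p \<in> A" and "coords (chart_at A p) p \<in> chart_dom (chart_at A p)"
proof -
  have "\<exists>c. c \<in> A \<and> p \<in> chart_map c ` chart_dom c" using assms by blast
  then have *: "chart_at A p \<in> A \<and> p \<in> chart_map (chart_at A p) ` chart_dom (chart_at A p)"
    unfolding chart_at_def by (rule someI_ex)
  then show "chart_at A p \<in> A" by simp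
  show "coords (chart_at A p) p \<in> chart_dom (chart_at A p)"
    unfolding coords_def using * by (blast intro: inv_into_into)
qed

text \<open>The value depends on \<open>r\<close> alone, so the arbitrary charts picked by
  \<open>chart_at\<close> leave no trace.\<close>

lemma extrinsic_curvature_eq:
  assumes B: "Nc B > 0" "alpha' B > 0" "R > 0" and Y: "riemannian_manifold (Y5 B) (Y5_atlas B)"
    and f: "continuous_on UNIV f" "f r > 0" "(f has_real_derivative f') (at r)"
    and p: "p \<in> S3" and q: "q \<in> Y5 B"
  shows "extrinsic_curvature B R f r p q = 2 * sqrt (f r / gamma_coeff B R) * exp (- dilaton B r / 4)"
proof -
  have c: "chart_at S3_atlas p \<in> S3_atlas"
    "coords (chart_at S3_atlas p) p \<in> chart_dom (chart_at S3_atlas p)"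
    using subsetD[OF S3_atlas_cover p] by (rule chart_at_coords)+
  have "q \<in> (\<Union>c\<in>Y5_atlas B. chart_map c ` chart_dom c)"
    using Y q by (simp add: riemannian_manifold_def)
  note d = chart_at_coords[OF this]
  have d': "open (chart_dom (chart_at (Y5_atlas B) q))"
    "\<And>y v. y \<in> chart_dom (chart_at (Y5_atlas B) q) \<Longrightarrow> v \<noteq> 0 \<Longrightarrow>
       v \<bullet> (chart_metric (chart_at (Y5_atlas B) q) y *v v) > 0"
    using Y d(1) by (auto simp: riemannian_manifold_def)
  have v: "(\<chi> k. w $ k) = w" for w :: "real^'n::finite" by (simp add: vec_eq_iff)
  show ?thesis
    unfolding extrinsic_curvature_def Let_def
  proof (rule slice_mean_curvature[OF B f])
    show "open (chart_dom (chart_at S3_atlas p))" using S3_atlas_chart(1)[OF c(1)] by simp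
  qed (use c d d' S3_atlas_positive_definite in \<open>auto simp: slice_coords_def v\<close>)
qed

lemma g_tt_eq: "g_tt B R f r p q = - exp (dilaton B r / 2) * f r"
  by (simp add: g_tt_def spacetime_metric_def slice_coords_def Let_def)

lemma f_bh_pos: "r0 < r \<Longrightarrow> f_bh r0 r > 0"
  by (simp add: f_bh_def)

lemma f_bh_tendsto: "(f_bh r0 \<longlongrightarrow> 1) at_top"
proof -
  have "filterlim (\<lambda>r. (- 2) * r) at_bot (at_top :: real filter)"
    by (rule filterlim_tendsto_neg_mult_at_bot[OF tendsto_const _ filterlim_ident]) simp
  then have "((\<lambda>r. 1 - exp (2 * r0) * exp ((- 2) * r)) \<longlongrightarrow> 1 - exp (2 * r0) * 0) at_top"
    by (intro tendsto_intros filterlim_compose[OF exp_at_bot])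
  then show ?thesis
    by (simp add: f_bh_def[abs_def] exp_add[symmetric] algebra_simps)
qed

lemma powr_five_halves:
  assumes "a > (0 :: real)"
  shows "a powr (5/2) = a\<^sup>2 * sqrt a"
proof -
  have "a powr (5/2) = a powr (2 + 1/2)" by simp
  also have "\<dots> = a\<^sup>2 * sqrt a"
    using assms by (subst powr_add) (simp add: powr_half_sqrt)
  finally show ?thesis .
qed

text \<open>The half-integer power from the volume of the \<open>Y5\<close> factor combines with the
  radial lapse to the integer power seen in the energy, and the root that remains is the ratio of
  the temperature to the Hagedorn temperature.\<close>

lemma inverse_sqrt_gamma_coeff:
  assumes "Nc B > 0" "alpha' B > 0" "R > 0"
  shows "(Nc B * alpha' B) powr (5/2) / sqrt (gamma_coeff B R) =
    (Nc B * alpha' B)\<^sup>2 * sqrt (1 + Nc B / R\<^sup>2)"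
proof -
  have a: "Nc B * alpha' B > 0" using assms by simp
  note p = powr_five_halves[OF a]
  have "gamma_coeff B R = Nc B * alpha' B / (1 + Nc B / R\<^sup>2)"
    using assms by (simp add: gamma_coeff_def field_simps)
  then have "sqrt (gamma_coeff B R) = sqrt (Nc B * alpha' B) / sqrt (1 + Nc B / R\<^sup>2)"
    by (simp add: real_sqrt_divide)
  then show ?thesis using a by (simp add: p)
qed

lemma measure_pair_space:
  assumes "sigma_finite_measure M" "sigma_finite_measure N"
  shows "measure (M \<Otimes>\<^sub>M N) (space (M \<Otimes>\<^sub>M N)) = measure M (space M) * measure N (space N)"
  using sigma_finite_measure.emeasure_pair_measure_Times[OF assms(2), of "space M" M "space N"]
  by (simp add: space_pair_measure measure_def enn2real_mult)

text \<open>Exact at every cut-off beyond the horizon; all dependence on \<open>r\<close> sits in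
  the last factor, so the limit concerns that factor only.\<close>

lemma cutoff_energy_eq:
  assumes B: "Nc B > 0" "alpha' B > 0" "R > 0" and Y: "riemannian_manifold (Y5 B) (Y5_atlas B)"
    and sp: "space (dOmega3 B) = S3" "space (dY5 B) = Y5 B"
    and fin: "sigma_finite_measure (dOmega3 B)" "sigma_finite_measure (dY5 B)"
    and r: "r0 < r"
  shows "cutoff_energy B R r0 r =
    exp (2 * phi0 B + 2 * r0) * (alpha' B)\<^sup>2 / (8 * pi * G10 B) * (Nc B)\<^sup>2
      * vol_S3 B R * vol_Y5 B * sqrt (1 + Nc B / R\<^sup>2)
      * (2 * sqrt (f_bh r0 r) / (1 + sqrt (f_bh r0 r)))"
proof -
  define w where "w = sqrt (f_bh r0 r)"
  define z where "z = 2 * w / (1 + w)"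
  \<comment> \<open>\<open>C\<close> is the constant value of the integrand: the dilaton
    exponentials of the curvature and of the redshift factor cancel, and \<open>w * (w - 1)\<close>
    remains because the reference profile has root 1.\<close>
  define C where "C = 2 * (w\<^sup>2 - w) / sqrt (gamma_coeff B R) * area_density B R r"
  have f: "f_bh r0 r > 0" using r by (rule f_bh_pos)
  then have w: "w > 0" "w\<^sup>2 = f_bh r0 r" by (simp_all add: w_def)
  have "(f_bh r0 has_real_derivative 2 * exp (2 * (r0 - r))) (at r)"
    unfolding f_bh_def by (auto intro!: derivative_eq_intros)
  moreover have "continuous_on UNIV (f_bh r0)" unfolding f_bh_def by (intro continuous_intros)
  ultimately have bh: "extrinsic_curvature B R (f_bh r0) r p q =
      2 * w / sqrt (gamma_coeff B R) * exp (- dilaton B r / 4)" if "p \<in> S3" "q \<in> Y5 B" for p q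
    using extrinsic_curvature_eq[OF B Y, of "f_bh r0" r _ p q] f that
    by (simp add: w_def real_sqrt_divide)
  have "(f_ref has_real_derivative 0) (at r)" "continuous_on UNIV f_ref" "f_ref r > 0"
    unfolding f_ref_def by auto
  then have ref: "extrinsic_curvature B R f_ref r p q =
      2 / sqrt (gamma_coeff B R) * exp (- dilaton B r / 4)" if "p \<in> S3" "q \<in> Y5 B" for p q
    using extrinsic_curvature_eq[OF B Y, of f_ref r 0 p q] that by (simp add: f_ref_def real_sqrt_divide)
  have gamma: "gamma_coeff B R > 0" using B by (simp add: gamma_coeff_def add_pos_pos)
  have "sqrt (exp (dilaton B r / 2)) = exp (dilaton B r / 4)"
    by (rule real_sqrt_unique) (simp_all add: power2_eq_square exp_add[symmetric])
  then have g: "sqrt \<bar>g_tt B R (f_bh r0) r p q\<bar> = exp (dilaton B r / 4) * w" for p q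
    using f by (simp add: g_tt_eq abs_mult real_sqrt_mult w_def)
  have "(extrinsic_curvature B R (f_bh r0) r p q - extrinsic_curvature B R f_ref r p q)
      * sqrt \<bar>g_tt B R (f_bh r0) r p q\<bar> * area_density B R r = C" if "p \<in> S3" "q \<in> Y5 B" for p q
    unfolding bh[OF that] ref[OF that] g C_def using gamma
    by (simp add: exp_minus field_simps power2_eq_square)
  then have "(\<integral>(p, q). (extrinsic_curvature B R (f_bh r0) r p q - extrinsic_curvature B R f_ref r p q)
      * sqrt \<bar>g_tt B R (f_bh r0) r p q\<bar> * area_density B R r \<partial>(dOmega3 B \<Otimes>\<^sub>M dY5 B))
    = (\<integral>x. C \<partial>(dOmega3 B \<Otimes>\<^sub>M dY5 B))"
    by (intro Bochner_Integration.integral_cong) (auto simp: space_pair_measure sp)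
  also have "\<dots> = measure (dOmega3 B) (space (dOmega3 B)) * vol_Y5 B * C"
    by (simp add: measure_pair_space[OF fin] vol_Y5_def)
  finally have "cutoff_energy B R r0 r =
      - (1 / (8 * pi * G10 B) * (measure (dOmega3 B) (space (dOmega3 B)) * vol_Y5 B * C))"
    by (simp add: cutoff_energy_def)
  also have "C = - (exp (2 * phi0 B + 2 * r0) * (Nc B * alpha' B)\<^sup>2 * sqrt (1 + Nc B / R\<^sup>2) * R ^ 3 * z)"
  proof -
    \<comment> \<open>Multiplying by \<open>1 + w\<close> exposes \<open>1 - w\<^sup>2\<close>, the
      exponential that compensates the growth of the area density. The sign it brings cancels the
      minus sign in \<open>cutoff_energy\<close>.\<close>
    have "(w\<^sup>2 - w) * (1 + w) = - w * (1 - w\<^sup>2)" by (simp add: power2_eq_square algebra_simps)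
    then have "w\<^sup>2 - w = - w / (1 + w) * (1 - w\<^sup>2)" using w(1) by (simp add: field_simps)
    moreover have "(1 - w\<^sup>2) * exp (2 * dilaton B r) = exp (2 * phi0 B + 2 * r0)"
      by (simp add: w(2) f_bh_def dilaton_def exp_add[symmetric] algebra_simps)
    ultimately have "(w\<^sup>2 - w) * exp (2 * dilaton B r) = - (w / (1 + w)) * exp (2 * phi0 B + 2 * r0)"
      by (simp add: mult.assoc)
    then have "2 * ((w\<^sup>2 - w) * exp (2 * dilaton B r)) * R ^ 3
        * ((Nc B * alpha' B) powr (5/2) / sqrt (gamma_coeff B R)) =
      2 * (- (w / (1 + w)) * exp (2 * phi0 B + 2 * r0)) * R ^ 3
        * ((Nc B * alpha' B)\<^sup>2 * sqrt (1 + Nc B / R\<^sup>2))"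
      using inverse_sqrt_gamma_coeff[OF B] by simp
    then show ?thesis by (simp add: z_def C_def area_density_def mult_ac del: right_diff_distrib_numeral left_diff_distrib_numeral)
  qed
  finally show ?thesis
    unfolding w_def[symmetric] z_def[symmetric] by (simp add: vol_S3_def power_mult_distrib mult_ac)
qed

section \<open>Thermodynamics\<close>

text \<open>\<open>inv (X R)\<close> is a genuine inverse only on the range of \<open>X R\<close>,
  the positive half-line. That set is open, so the derivative at one of its points can be computed
  from \<open>F\<close>, which expresses \<open>Z\<close> through \<open>X\<close> there.\<close>

lemma has_fixed_volume_derivative_exponential:
  assumes X: "\<And>r. X R r = a * exp (2 * r)" and a: "a > 0"
    and Z: "\<And>r. Z R r = F (X R r)" and F: "(F has_real_derivative D) (at (X R r0))"
  shows "has_fixed_volume_derivative Z X D R r0"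
proof -
  have inj: "inj (X R)" using a by (auto intro!: injI simp: X)
  have "F \<xi> = Z R (inv (X R) \<xi>)" if "\<xi> \<in> {0<..}" for \<xi>
  proof -
    have "\<xi> = X R (ln (\<xi> / a) / 2)" using a that by (simp add: X)
    then show ?thesis using Z f_inv_into_f[of \<xi> "X R" UNIV] by (metis rangeI)
  qed
  then have "((\<lambda>\<xi>. Z R (inv (X R) \<xi>)) has_real_derivative D) (at (X R r0))"
    using F a by (intro has_field_derivative_transform_within_open[OF F, of "{0<..}"]) (auto simp: X)
  then show ?thesis using inj by (simp add: has_fixed_volume_derivative_def)
qed

text \<open>\<open>ln (\<Omega> e) - e / t\<close> has derivative zero on the convex set of positive
  \<open>e\<close>, hence is a constant \<open>c\<close>; positivity of \<open>\<Omega>\<close>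
  allows the logarithm to be undone, with \<open>\<Omega>0 = exp c\<close>.\<close>

lemma log_derivative_constant_iff:
  fixes \<Omega> :: "real \<Rightarrow> real"
  shows "(\<forall>e>0. \<Omega> e > 0 \<and> ((\<lambda>e. ln (\<Omega> e)) has_real_derivative 1 / t) (at e)) \<longleftrightarrow>
    (\<exists>\<Omega>0>0. \<forall>e>0. \<Omega> e = \<Omega>0 * exp (e / t))" (is "?L \<longleftrightarrow> ?R")
proof
  assume L: ?L
  have "((\<lambda>e. ln (\<Omega> e) - e / t) has_real_derivative 0) (at e within {0<..})" if "e \<in> {0<..}" for e
  proof -
    have "((\<lambda>e. ln (\<Omega> e) - e / t) has_real_derivative 1 / t - 1 / t) (at e)"
      using L that by (intro DERIV_diff DERIV_cdivide DERIV_ident) simp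
    then show ?thesis by (simp add: has_field_derivative_at_within)
  qed
  then obtain c where c: "\<And>e. e \<in> {0<..} \<Longrightarrow> ln (\<Omega> e) - e / t = c"
    using has_field_derivative_zero_constant[of "{0<..} :: real set" "\<lambda>e. ln (\<Omega> e) - e / t"] by auto
  have "\<Omega> e = exp c * exp (e / t)" if "e > 0" for e
  proof -
    have "\<Omega> e = exp (ln (\<Omega> e))" using L that by simp
    also have "ln (\<Omega> e) = c + e / t" using c[of e] that by simp
    finally show ?thesis by (simp add: exp_add)
  qed
  then show ?R by (intro exI[of _ "exp c"]) auto
next
  assume ?R
  then obtain \<Omega>0 where \<Omega>0: "\<Omega>0 > 0" "\<And>e. e > 0 \<Longrightarrow> \<Omega> e = \<Omega>0 * exp (e / t)" by blast
  have "((\<lambda>e. ln (\<Omega> e)) has_real_derivative 1 / t) (at e)" if "e > 0" for e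
  proof (rule has_field_derivative_transform_within_open)
    have "((\<lambda>e. ln \<Omega>0 + e / t) has_real_derivative 0 + 1 / t) (at e)"
      by (intro DERIV_add DERIV_const DERIV_cdivide DERIV_ident)
    then show "((\<lambda>e. ln \<Omega>0 + e / t) has_real_derivative 1 / t) (at e)" by simp
    show "ln \<Omega>0 + x / t = ln (\<Omega> x)" if "x \<in> {0<..}" for x
      using \<Omega>0 that by (simp add: ln_mult)
  qed (use that in auto)
  then show ?L using \<Omega>0 by auto
qed

text \<open>\<open>energy\<close> is defined by \<open>Lim\<close>, a term that denotes some value
  even without convergence, so convergence is a conjunct of its own. The density of states is
  characterized by an equivalence, which also yields that such densities exist.\<close>

theorem mainTheorem1:
  fixes B :: "'y::t2_space background" and R r0 :: real
  assumes "Nc B > 0" and "alpha' B > 0" and "G10 B > 0"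
    and "riemannian_manifold (Y5 B) (Y5_atlas B)" and "compact (Y5 B)" and "Y5 B \<noteq> {}"
    and "riemannian_measure (Y5 B) (Y5_atlas B) (dY5 B)"
    and "riemannian_measure S3 S3_atlas (dOmega3 B)"
    and "R > 0"
  shows "((cutoff_energy B R r0 \<longlongrightarrow> energy B R r0) at_top) \<and>
    (energy B R r0 =
           exp (2 * phi0 B + 2 * r0) * (alpha' B)\<^sup>2 / (8 * pi * G10 B) * (Nc B)\<^sup>2
             * vol_S3 B R * vol_Y5 B * (temperature B R r0 / hagedorn_temperature B)) \<and>
    (energy B R r0 = temperature B R r0 * entropy B R r0) \<and>
    (free_energy B R r0 = 0) \<and>
    (has_fixed_volume_derivative (energy B) (entropy B) (temperature B R r0) R r0) \<and>
    (has_fixed_volume_derivative (temperature B) (energy B) 0 R r0) \<and>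
    (\<forall>\<Omega>. density_of_states B R \<Omega> \<longleftrightarrow>
           (\<exists>\<Omega>0>0. \<forall>e\<in>range (energy B R). \<Omega> e = \<Omega>0 * exp (e / temperature B R r0))) \<and>
    (\<forall>\<Omega> a. density_of_states B R \<Omega> \<longrightarrow>
           ((\<exists>C. \<forall>e\<in>range (energy B R). \<Omega> e = C * e powr a * exp (e / temperature B R r0))
             \<longleftrightarrow> a = 0))"
proof -
  note B = assms(1,2,9)

  \<comment> \<open>Finite and positive volumes of the two compact factors\<close>
  have sp: "space (dOmega3 B) = S3" "space (dY5 B) = Y5 B"
    using assms(7,8) by (simp_all add: riemannian_measure_def)
  have "compact S3" "S3 \<noteq> {}" using stereographic_in_S3[of 1 0] by (auto simp: S3_def)
  then have S3_fin: "finite_measure (dOmega3 B)" and S3_pos: "measure (dOmega3 B) (space (dOmega3 B)) > 0"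
    using compact_riemannian_measure[OF _ _ assms(8) S3_atlas_cover] S3_atlas_chart S3_atlas_positive_definite
    by (simp_all)
  have chart: "open (chart_dom c)" "inj_on (chart_map c) (chart_dom c)"
      "continuous_on (chart_dom c) (chart_metric c)"
      "openin (top_of_set (Y5 B)) (chart_map c ` U)"
    if c: "c \<in> Y5_atlas B" and U: "open U" "U \<subseteq> chart_dom c" for c U
  proof -
    have *: "open (chart_dom c)" "openin (top_of_set (Y5 B)) (chart_map c ` chart_dom c)"
      "homeomorphism (chart_dom c) (chart_map c ` chart_dom c) (chart_map c) (coords c)"
      "smooth_on (chart_dom c) (chart_metric c)"
      using assms(4) c by (auto simp: riemannian_manifold_def)
    show "open (chart_dom c)" by (rule *(1))
    show "inj_on (chart_map c) (chart_dom c)"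
      using *(3) unfolding homeomorphism_def by (intro inj_on_inverseI[of _ "coords c"]) blast
    show "continuous_on (chart_dom c) (chart_metric c)"
      using *(4) unfolding smooth_on_def by (metis Ck_on.simps(1))
    \<comment> \<open>The homeomorphism carries \<open>U\<close> to a set open in the image of the
      chart, and that image is itself open in \<open>Y5 B\<close>.\<close>
    have "openin (top_of_set (chart_dom c)) U" using U by (simp add: openin_open_eq[OF *(1)])
    then show "openin (top_of_set (Y5 B)) (chart_map c ` U)"
      using homeomorphism_imp_open_map[OF *(3)] openin_trans *(2) by blast
  qed
  have "Y5 B \<subseteq> (\<Union>c\<in>Y5_atlas B. chart_map c ` chart_dom c)"
    and "\<And>c x v. c \<in> Y5_atlas B \<Longrightarrow> x \<in> chart_dom c \<Longrightarrow> v \<noteq> 0 \<Longrightarrow> v \<bullet> (chart_metric c x *v v) > 0"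
    using assms(4) by (auto simp: riemannian_manifold_def)
  then have Y5_fin: "finite_measure (dY5 B)" and Y5_pos: "measure (dY5 B) (space (dY5 B)) > 0"
    using compact_riemannian_measure[OF assms(5,6,7)] chart(1-3)[OF _ open_empty empty_subsetI] chart(4)
    by simp_all
  \<comment> \<open>Strict positivity matters below: with a vanishing volume the energy would be
    identically zero and could not serve as a coordinate on the states.\<close>
  have vol: "vol_S3 B R > 0" "vol_Y5 B > 0"
    using S3_pos Y5_pos \<open>R > 0\<close> by (simp_all add: vol_S3_def vol_Y5_def)
  have TH: "hagedorn_temperature B > 0" using assms(1,2) by (simp add: hagedorn_temperature_def)
  have TT: "temperature B R r / hagedorn_temperature B = sqrt (1 + Nc B / R\<^sup>2)" for r
    using TH by (simp add: temperature_def)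
  define t where "t = temperature B R r0"
  have t: "temperature B R r = t" for r by (simp add: t_def temperature_def)
  have "t > 0" unfolding t_def temperature_def using TH B by (simp add: add_pos_pos)

  \<comment> \<open>The limit of the cut-off energy\<close>
  define E where "E r = exp (2 * phi0 B + 2 * r) * (alpha' B)\<^sup>2 / (8 * pi * G10 B) * (Nc B)\<^sup>2
             * vol_S3 B R * vol_Y5 B * sqrt (1 + Nc B / R\<^sup>2)" for r
  \<comment> \<open>Shown for every horizon parameter, since the derivatives and the range of the
    energy involve all states of the given \<open>R\<close>.\<close>
  have lim: "(cutoff_energy B R r \<longlongrightarrow> E r) at_top" for r
  proof -
    have "((\<lambda>x. E r * (2 * sqrt (f_bh r x) / (1 + sqrt (f_bh r x)))) \<longlongrightarrow>
        E r * (2 * sqrt 1 / (1 + sqrt 1))) at_top"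
      by (intro tendsto_intros f_bh_tendsto) auto
    moreover have "eventually (\<lambda>x. E r * (2 * sqrt (f_bh r x) / (1 + sqrt (f_bh r x))) = cutoff_energy B R r x) at_top"
      using eventually_gt_at_top[of r]
      by eventually_elim (simp add: E_def cutoff_energy_eq[OF B assms(4) sp
            finite_measure.axioms(1)[OF S3_fin] finite_measure.axioms(1)[OF Y5_fin]])
    ultimately show ?thesis by (simp add: filterlim_cong[OF refl refl, symmetric] Lim_transform_eventually)
  qed
  then have E: "energy B R r = E r" for r
    unfolding energy_def by (intro tendsto_Lim) auto

  \<comment> \<open>Energy, entropy and density of states at fixed volume\<close>
  define s where "s = exp (2 * phi0 B) * (Nc B * alpha' B) powr (5/2) * vol_S3 B R * vol_Y5 B / (4 * G10 B)"
  have "s > 0" using vol assms(1-3) by (simp add: s_def)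
  have S: "entropy B R r = s * exp (2 * r)" for r
    by (simp add: entropy_def horizon_area_def s_def exp_add)
  have ES: "energy B R r = t * entropy B R r" for r
  proof -
    have a: "Nc B * alpha' B > 0" using assms by simp
    note p = powr_five_halves[OF a]
    \<comment> \<open>The root split off from the power 5/2 meets the Hagedorn temperature; the
      resulting \<open>1 / (2 * pi)\<close> turns the \<open>4 * G10 B\<close> of the entropy into
      the \<open>8 * pi * G10 B\<close> of the energy.\<close>
    have "sqrt (Nc B * alpha' B) * hagedorn_temperature B = 1 / (2 * pi)"
      using a assms(1,2) by (simp add: hagedorn_temperature_def)
    moreover have "t * entropy B R r =
        (sqrt (Nc B * alpha' B) * hagedorn_temperature B) * (Nc B * alpha' B)\<^sup>2 * sqrt (1 + Nc B / R\<^sup>2)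
          * exp (2 * phi0 B + 2 * r) * vol_S3 B R * vol_Y5 B / (4 * G10 B)"
      by (simp add: t_def temperature_def entropy_def horizon_area_def p)
    ultimately show ?thesis by (simp add: E E_def power_mult_distrib mult_ac)
  qed
  have E_exp: "energy B R r = t * s * exp (2 * r)" for r by (simp add: ES S)
  have ts: "t * s > 0" using \<open>t > 0\<close> \<open>s > 0\<close> by simp
  \<comment> \<open>Knowing the range exactly turns statements about attained energies into
    statements about all positive \<open>e\<close>. The witness solves
    \<open>t * s * exp (2 * r) = e\<close> for \<open>r\<close>.\<close>
  have range: "range (energy B R) = {0<..}"
  proof -
    have "e \<in> range (energy B R)" if "e > 0" for e
      using that ts by (intro image_eqI[of _ _ "ln (e / (t * s)) / 2"]) (auto simp: E_exp)
    then show ?thesis using ts by (auto simp: E_exp)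
  qed
  have dos: "density_of_states B R \<Omega> \<longleftrightarrow> (\<exists>\<Omega>0>0. \<forall>e>0. \<Omega> e = \<Omega>0 * exp (e / t))" for \<Omega>
  proof -
    have "density_of_states B R \<Omega> \<longleftrightarrow>
      (\<forall>e\<in>range (energy B R). \<Omega> e > 0 \<and> ((\<lambda>e. ln (\<Omega> e)) has_real_derivative 1 / t) (at e))"
      by (simp add: density_of_states_def t)
    then show ?thesis unfolding range log_derivative_constant_iff[symmetric] by auto
  qed
  have exponent: "(\<exists>C. \<forall>e>0. \<Omega> e = C * e powr a * exp (e / t)) \<longleftrightarrow> a = 0"
    if dens: "density_of_states B R \<Omega>" for \<Omega> a
  proof -
    obtain \<Omega>0 where \<Omega>0: "\<Omega>0 > 0" "\<And>e. e > 0 \<Longrightarrow> \<Omega> e = \<Omega>0 * exp (e / t)"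
      using dens dos by blast
    show ?thesis
    proof
      assume "\<exists>C. \<forall>e>0. \<Omega> e = C * e powr a * exp (e / t)"
      then obtain C where "\<And>e. e > 0 \<Longrightarrow> \<Omega> e = C * e powr a * exp (e / t)" by blast
      then have *: "\<Omega>0 = C * e powr a" if "e > 0" for e
        using \<Omega>0(2)[OF that] that by (metis exp_not_eq_zero mult_right_cancel)
      \<comment> \<open>At \<open>e = 1\<close> the power is 1 and \<open>C\<close> equals
        \<open>\<Omega>0\<close>; since this is nonzero, \<open>e = 2\<close> settles the
        exponent.\<close>
      have "2 powr a = 1" using *[of 1] *[of 2] \<Omega>0(1) by auto
      then show "a = 0" by (simp add: powr_eq_one_iff_gen)
    qed (use \<Omega>0 in auto)
  qed
  \<comment> \<open>Both derivatives use that \<open>t\<close> is the same for all states of the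
    given \<open>R\<close>: the energy is \<open>t\<close> times the entropy, and the temperature is
    a constant function of the energy.\<close>
  have "has_fixed_volume_derivative (energy B) (entropy B) t R r0"
    by (rule has_fixed_volume_derivative_exponential[where X = "entropy B" and Z = "energy B" and R = R and F = "\<lambda>\<xi>. t * \<xi>", OF S \<open>s > 0\<close> ES])
      (auto intro!: derivative_eq_intros)
  moreover have "has_fixed_volume_derivative (temperature B) (energy B) 0 R r0"
    by (rule has_fixed_volume_derivative_exponential[where X = "energy B" and Z = "temperature B" and R = R and F = "\<lambda>_. t", OF E_exp ts]) (auto simp: t)
  moreover have "free_energy B R r0 = 0" by (simp add: free_energy_def ES t)
  moreover have "energy B R r0 =
           exp (2 * phi0 B + 2 * r0) * (alpha' B)\<^sup>2 / (8 * pi * G10 B) * (Nc B)\<^sup>2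
             * vol_S3 B R * vol_Y5 B * (temperature B R r0 / hagedorn_temperature B)"
    by (simp only: TT E E_def)
  moreover have "(cutoff_energy B R r0 \<longlongrightarrow> energy B R r0) at_top" using lim by (simp add: E)
  moreover have "(\<forall>e\<in>range (energy B R). P e) \<longleftrightarrow> (\<forall>e>0. P e)" for P
    unfolding range by auto
  ultimately show ?thesis
    using exponent unfolding t by (intro conjI allI impI) (simp_all only: dos ES)
qed

end
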